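(* Let $d\ge1$, $\beta>\frac d2+1$, $V(x)=1+|x|^2$ for $x\in\mathbb{R}^d$, and let $\pi_\beta=Z_\beta^{-1}V^{-\beta}$ with $Z_\beta=\int_{\mathbb{R}^d}(1+|x|^2)^{-\beta}dx$. Then $$\mathbb{E}_{\pi_\beta}[V(X)]=\frac{\beta-1}{\beta-1-\frac d2}\qquad\text{and}\qquad\mathbb{E}_{\pi_\beta}\left[|\nabla V(X)|^2\right]=\frac{2d}{\beta-1-\frac d2}.$$
   Context: $|\cdot|$ is the Euclidean norm; $\mathbb{E}_{\pi_\beta}$ denotes expectation with $X$ distributed according to the probability density $\pi_\beta$. *)

theory Defs
  imports "HOL-Probability.Probability"
begin

definition V :: "real ^ 'n \<Rightarrow> real" where
  "V x = 1 + (norm x)\<^sup>2"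

(* The type argument carries the dimension d = CARD('n). *)
definition Z :: "('n::finite) itself \<Rightarrow> real \<Rightarrow> real" where
  "Z _ \<beta> = (\<integral>x. (1 + (norm (x :: real ^ 'n))\<^sup>2) powr (-\<beta>) \<partial>lborel)"

definition pi_density :: "real \<Rightarrow> real ^ ('n::finite) \<Rightarrow> real" where
  "pi_density \<beta> x = inverse (Z TYPE('n) \<beta>) * V x powr (-\<beta>)"

definition pi_measure :: "real \<Rightarrow> (real ^ ('n::finite)) measure" where
  "pi_measure \<beta> = density lborel (\<lambda>x. ennreal (pi_density \<beta> x))"

(* Unspecified where f is not differentiable. *)
definition grad :: "('a::real_inner \<Rightarrow> real) \<Rightarrow> 'a \<Rightarrow> 'a" where
  "grad f x = (THE D. GDERIV f x :> D)"

end

theory Submission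
  imports Defs
begin

text \<open>
  Up to the normalising constant both expectations are values of
  \<open>I(s) = \<integral> (1 + |x|\<^sup>2) powr - s dx\<close>: the first one is \<open>I(\<beta> - 1) / I(\<beta>)\<close>, and since
  \<open>|\<nabla>V|\<^sup>2 = 4|x|\<^sup>2 = 4(V - 1)\<close>, the second one is four times the first minus four.

  To compute \<open>I(s)\<close>, the power is written as a mixture of Gaussians,
  \<open>\<Gamma>(s) a powr - s = \<integral> t powr (s - 1) exp (- a t) dt\<close> over \<open>t > 0\<close>, with \<open>a = 1 + |x|\<^sup>2\<close>.
  Everything is nonnegative, so the integrals over \<open>t\<close> and \<open>x\<close> may be exchanged; the Gaussian
  integral over \<open>x\<close> is \<open>(pi / t) powr (d / 2)\<close>, and what remains is again a Gamma integral, with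
  parameter \<open>s - d / 2\<close>. Hence \<open>I(s) = pi powr (d / 2) \<Gamma>(s - d / 2) / \<Gamma>(s)\<close>
  (\<open>nn_integral_one_plus_norm_sq_powr\<close>). The functional equation of \<open>\<Gamma>\<close> turns the quotient
  \<open>I(\<beta> - 1) / I(\<beta>)\<close> into \<open>(\<beta> - 1) / (\<beta> - 1 - d / 2)\<close>.
\<close>

text \<open>
  The substitution \<open>t \<mapsto> a t\<close> reduces this to Euler's integral for \<open>\<Gamma>(s)\<close>. The nonnegative
  integral is used because it needs no integrability proof when the order of integration is
  exchanged below, and its finite value then yields integrability.
\<close>
lemma nn_integral_Gamma_rate:
  fixes a s :: real
  assumes "a > 0" "s > 0"
  shows "(\<integral>\<^sup>+ t. ennreal (indicator {0..} t * t powr (s - 1) * exp (- (a * t))) \<partial>lborel)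
           = ennreal (Gamma s * a powr (- s))"
proof -
  let ?f = "\<lambda>t::real. indicator {0..} t * (t powr (s - 1) / exp t)"
  have "((\<lambda>t. if t \<in> {0..} then t powr (s - 1) / exp t else 0) has_integral Gamma s) UNIV"
    using Gamma_integral_real[OF assms(2)] by (subst has_integral_restrict_UNIV)
  also have "(\<lambda>t. if t \<in> {0..} then t powr (s - 1) / exp t else 0) = ?f"
    by (auto simp: indicator_def)
  finally have "(?f has_integral Gamma s) UNIV" .
  then have "ennreal (Gamma s) = (\<integral>\<^sup>+ t. ennreal (?f t) \<partial>lborel)"
    by (intro nn_integral_has_integral_lborel[symmetric]) auto
  also have "\<dots> = ennreal a * (\<integral>\<^sup>+ t. ennreal (?f (a * t)) \<partial>lborel)"
    using nn_integral_real_affine[of "\<lambda>t. ennreal (?f t)" a 0] assms by simp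
  also have "(\<integral>\<^sup>+ t. ennreal (?f (a * t)) \<partial>lborel)
      = (\<integral>\<^sup>+ t. ennreal (a powr (s - 1)) *
            ennreal (indicator {0..} t * t powr (s - 1) * exp (- (a * t))) \<partial>lborel)"
    using assms
    by (intro nn_integral_cong)
       (auto simp: ennreal_mult'[symmetric] powr_mult exp_minus divide_inverse zero_le_mult_iff
             split: split_indicator)
  also have "\<dots> = ennreal (a powr (s - 1)) *
      (\<integral>\<^sup>+ t. ennreal (indicator {0..} t * t powr (s - 1) * exp (- (a * t))) \<partial>lborel)" (is "_ = _ * ?I")
    by (intro nn_integral_cmult) auto
  finally have "ennreal (Gamma s) = ennreal (a powr s) * ?I"
    using assms by (simp add: mult.assoc[symmetric] ennreal_mult'[symmetric] powr_mult_base)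
  then have "ennreal (a powr - s) * ennreal (Gamma s) = ennreal (a powr - s * a powr s) * ?I"
    by (simp add: ennreal_mult' mult.assoc)
  also have "a powr - s * a powr s = 1"
    using assms by (simp add: powr_add[symmetric])
  finally have "?I = ennreal (a powr - s) * ennreal (Gamma s)"
    by simp
  also have "\<dots> = ennreal (Gamma s * a powr - s)"
    by (simp add: ennreal_mult''[symmetric] mult.commute)
  finally show ?thesis .
qed

text \<open>
  The integrand is a multiple of the centred normal density of variance \<open>1 / (2 t)\<close>, which has
  total mass one.
\<close>
lemma nn_integral_gaussian_rate:
  fixes t :: real
  assumes "t > 0"
  shows "(\<integral>\<^sup>+ x. ennreal (exp (- (t * x\<^sup>2))) \<partial>lborel) = ennreal (sqrt (pi / t))"
proof -
  let ?\<sigma> = "sqrt (1 / (2 * t))"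
  have \<sigma>: "?\<sigma> > 0" "?\<sigma>\<^sup>2 = 1 / (2 * t)"
    using assms by auto
  have eq: "exp (- (t * x\<^sup>2)) = sqrt (pi / t) * normal_density 0 ?\<sigma> x" for x
    using assms unfolding normal_density_def \<sigma>(2)
    by (simp add: real_sqrt_divide)
  have "(\<integral>\<^sup>+ x. ennreal (exp (- (t * x\<^sup>2))) \<partial>lborel)
      = (\<integral>x. exp (- (t * x\<^sup>2)) \<partial>lborel)"
    unfolding eq using \<sigma> by (intro nn_integral_eq_integral) (auto simp: assms less_imp_le)
  also have "(\<integral>x. exp (- (t * x\<^sup>2)) \<partial>lborel) = sqrt (pi / t)"
    unfolding eq using \<sigma> by simp
  finally show ?thesis .
qed

text \<open>
  By Pythagoras the Gaussian factors over the coordinates, and so does its integral.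
\<close>
lemma nn_integral_gaussian_rate_euclidean:
  fixes t :: real
  assumes "t > 0"
  shows "(\<integral>\<^sup>+ x. ennreal (exp (- (t * (norm (x :: 'a::euclidean_space))\<^sup>2))) \<partial>lborel)
           = ennreal ((pi / t) powr (real DIM('a) / 2))"
proof -
  have "ennreal (exp (- (t * (norm (x :: 'a))\<^sup>2)))
      = (\<Prod>b\<in>Basis. ennreal (exp (- (t * (x \<bullet> b)\<^sup>2))))" for x :: 'a
  proof -
    have "(norm x)\<^sup>2 = (\<Sum>b\<in>Basis. (x \<bullet> b)\<^sup>2)"
      unfolding power2_norm_eq_inner by (subst euclidean_inner) (simp add: power2_eq_square)
    then show ?thesis
      by (simp add: prod_ennreal exp_sum[symmetric] sum_distrib_left sum_negf)
  qed
  then have "(\<integral>\<^sup>+ x. ennreal (exp (- (t * (norm (x :: 'a))\<^sup>2))) \<partial>lborel)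
      = (\<integral>\<^sup>+ x. (\<Prod>b\<in>(Basis :: 'a set). ennreal (exp (- (t * (x \<bullet> b)\<^sup>2)))) \<partial>lborel)"
    by (rule nn_integral_cong)
  also have "\<dots> = (\<Prod>b\<in>(Basis :: 'a set). \<integral>\<^sup>+ y. ennreal (exp (- (t * y\<^sup>2))) \<partial>lborel)"
    by (rule nn_integral_lborel_prod) auto
  also have "\<dots> = ennreal (sqrt (pi / t) ^ DIM('a))"
    using assms by (simp add: nn_integral_gaussian_rate ennreal_power)
  also have "sqrt (pi / t) ^ DIM('a) = (pi / t) powr (real DIM('a) / 2)"
    using assms by (simp add: powr_half_sqrt[symmetric] powr_powr powr_realpow[symmetric])
  finally show ?thesis .
qed

text \<open>
  The Gaussian mixture computation. It is carried out after multiplication by \<open>\<Gamma>(s)\<close>, which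
  is divided out in the last steps. The hypothesis on \<open>s\<close> is what makes the remaining Gamma
  integral, with parameter \<open>s - d / 2\<close>, converge.
\<close>
lemma nn_integral_one_plus_norm_sq_powr:
  fixes s :: real
  assumes s: "s > real DIM('a::euclidean_space) / 2"
  shows "(\<integral>\<^sup>+ x. ennreal ((1 + (norm (x :: 'a))\<^sup>2) powr (- s)) \<partial>lborel)
           = ennreal (pi powr (real DIM('a) / 2) * Gamma (s - real DIM('a) / 2) / Gamma s)"
proof -
  let ?d = "real DIM('a) / 2"
  let ?g = "\<lambda>(x::'a) t::real. indicator {0..} t * t powr (s - 1) * exp (- ((1 + (norm x)\<^sup>2) * t))"
  let ?w = "\<lambda>t::real. indicator {0..} t * t powr (s - 1) * exp (- t)"
  have "s > 0"
    using s by (rule le_less_trans[rotated]) simp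
  have pos: "1 + (norm x)\<^sup>2 > 0" for x :: 'a
    by (rule add_pos_nonneg) auto
  have "ennreal (Gamma s) * (\<integral>\<^sup>+ x. ennreal ((1 + (norm (x :: 'a))\<^sup>2) powr (- s)) \<partial>lborel)
      = (\<integral>\<^sup>+ x. ennreal (Gamma s * (1 + (norm (x :: 'a))\<^sup>2) powr (- s)) \<partial>lborel)"
    using \<open>s > 0\<close> by (subst nn_integral_cmult[symmetric]) (auto simp: ennreal_mult')
  also have "\<dots> = (\<integral>\<^sup>+ x. (\<integral>\<^sup>+ t. ennreal (?g x t) \<partial>lborel) \<partial>lborel)"
    by (intro nn_integral_cong nn_integral_Gamma_rate[symmetric] pos \<open>s > 0\<close>)
  also have "\<dots> = (\<integral>\<^sup>+ t. (\<integral>\<^sup>+ x. ennreal (?g x t) \<partial>lborel) \<partial>lborel)"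
    by (rule lborel_pair.Fubini'[symmetric]) (simp add: split_def)
  also have "\<dots> = (\<integral>\<^sup>+ t. ennreal (pi powr ?d) *
      ennreal (indicator {0..} t * t powr (s - ?d - 1) * exp (- (1 * t))) \<partial>lborel)"
  proof (intro nn_integral_cong)
    fix t :: real
    show "(\<integral>\<^sup>+ x. ennreal (?g x t) \<partial>lborel)
        = ennreal (pi powr ?d) * ennreal (indicator {0..} t * t powr (s - ?d - 1) * exp (- (1 * t)))"
    proof (cases "t > 0")
      case True
      have "(\<integral>\<^sup>+ x. ennreal (?g x t) \<partial>lborel)
          = (\<integral>\<^sup>+ x. ennreal (?w t) * ennreal (exp (- (t * (norm (x :: 'a))\<^sup>2))) \<partial>lborel)"
        by (intro nn_integral_cong)
           (simp add: ennreal_mult'[symmetric] exp_add[symmetric] algebra_simps)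
      also have "\<dots> = ennreal (?w t) * ennreal ((pi / t) powr ?d)"
        using True by (subst nn_integral_cmult) (auto simp: nn_integral_gaussian_rate_euclidean)
      also have "\<dots> = ennreal (?w t * (pi / t) powr ?d)"
        by (simp add: ennreal_mult')
      also have "?w t * (pi / t) powr ?d
          = pi powr ?d * (indicator {0..} t * t powr (s - ?d - 1) * exp (- (1 * t)))"
      proof -
        have "t powr (s - ?d - 1) = t powr (s - 1) / t powr ?d"
          using True by (simp add: powr_diff[symmetric] algebra_simps)
        then show ?thesis
          using True by (simp add: powr_divide)
      qed
      finally show ?thesis
        by (simp add: ennreal_mult')
    next
      \<comment> \<open>At \<open>t = 0\<close> the Gaussian integral diverges, but its weight is \<open>0 powr (s - 1) = 0\<close>.\<close>
      case False
      then show ?thesis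
        by (cases "t = 0") auto
    qed
  qed
  also have "\<dots> = ennreal (pi powr ?d) * ennreal (Gamma (s - ?d) * 1 powr (- (s - ?d)))"
    using s by (simp add: nn_integral_cmult nn_integral_Gamma_rate[of 1, simplified])
  finally have "ennreal (Gamma s) * (\<integral>\<^sup>+ x. ennreal ((1 + (norm (x :: 'a))\<^sup>2) powr (- s)) \<partial>lborel)
      = ennreal (pi powr ?d * Gamma (s - ?d))" (is "_ * ?I = _")
    by (simp add: ennreal_mult')
  then have "ennreal (inverse (Gamma s)) * ennreal (Gamma s) * ?I
      = ennreal (inverse (Gamma s)) * ennreal (pi powr ?d * Gamma (s - ?d))"
    by (simp add: mult.assoc)
  moreover have "ennreal (inverse (Gamma s)) * ennreal (Gamma s) = 1"
    using Gamma_real_pos[OF \<open>s > 0\<close>] by (simp add: ennreal_mult'[symmetric])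
  ultimately have "?I = ennreal (inverse (Gamma s)) * ennreal (pi powr ?d * Gamma (s - ?d))"
    by simp
  also have "\<dots> = ennreal (inverse (Gamma s) * (pi powr ?d * Gamma (s - ?d)))"
    using Gamma_real_pos[OF \<open>s > 0\<close>] by (intro ennreal_mult'[symmetric]) simp
  also have "inverse (Gamma s) * (pi powr ?d * Gamma (s - ?d)) = pi powr ?d * Gamma (s - ?d) / Gamma s"
    by (rule divide_inverse_commute[symmetric])
  finally show ?thesis .
qed

lemma has_bochner_integral_one_plus_norm_sq_powr:
  fixes s :: real
  assumes "s > real DIM('a::euclidean_space) / 2"
  shows "has_bochner_integral lborel (\<lambda>x::'a. (1 + (norm x)\<^sup>2) powr (- s))
           (pi powr (real DIM('a) / 2) * Gamma (s - real DIM('a) / 2) / Gamma s)"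
proof (rule has_bochner_integral_nn_integral)
  have "s > 0"
    using assms by (rule le_less_trans[rotated]) simp
  then show "0 \<le> pi powr (real DIM('a) / 2) * Gamma (s - real DIM('a) / 2) / Gamma s"
    using assms by (auto intro!: divide_nonneg_nonneg mult_nonneg_nonneg)
qed (auto simp: nn_integral_one_plus_norm_sq_powr[OF assms])

text \<open>
  As \<open>grad\<close> is a definite description, its value also depends on uniqueness: two vectors
  representing the same derivative have the same inner product with every vector.
\<close>
lemma grad_eqI:
  assumes "GDERIV f x :> D"
  shows "grad f x = D"
  unfolding grad_def
proof (rule the_equality)
  show "GDERIV f x :> D" by (rule assms)
next
  fix E assume "GDERIV f x :> E"
  then have "(\<lambda>h. h \<bullet> E) = (\<lambda>h. h \<bullet> D)"
    using assms unfolding gderiv_def by (rule has_derivative_unique)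
  then show "E = D"
    by (metis vector_eq_ldot)
qed

lemma grad_V: "grad V x = 2 *\<^sub>R x"
proof (rule grad_eqI)
  show "GDERIV V x :> 2 *\<^sub>R x"
    unfolding V_def[abs_def] gderiv_def power2_norm_eq_inner
    by (auto intro!: derivative_eq_intros simp: inner_commute)
qed

theorem proposition2:
  fixes \<beta> :: real
  assumes "\<beta> > real CARD('n::finite) / 2 + 1"
  shows "prob_space.expectation (pi_measure \<beta> :: (real ^ 'n) measure) (\<lambda>x. V x)
           = (\<beta> - 1) / (\<beta> - 1 - real CARD('n) / 2)
       \<and> prob_space.expectation (pi_measure \<beta> :: (real ^ 'n) measure) (\<lambda>x. (norm (grad V x))\<^sup>2)
           = 2 * real CARD('n) / (\<beta> - 1 - real CARD('n) / 2)"
proof -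
  let ?d = "real CARD('n) / 2"
  let ?I = "\<lambda>s. pi powr ?d * Gamma (s - ?d) / Gamma s"
  let ?E = "\<lambda>f :: real ^ 'n \<Rightarrow> real. integral\<^sup>L (pi_measure \<beta>) f"
  have d: "?d > 0" by simp
  have I: "has_bochner_integral lborel (\<lambda>x :: real ^ 'n. V x powr (- s)) (?I s)" if "s > ?d" for s
    using has_bochner_integral_one_plus_norm_sq_powr[where 'a = "real ^ 'n", of s] that
    by (simp add: V_def)
  have V_pos: "V x > 0" for x :: "real ^ 'n"
    unfolding V_def by (rule add_pos_nonneg) auto
  have [measurable]: "V \<in> borel_measurable (borel :: (real ^ 'n) measure)"
    unfolding V_def[abs_def] by measurable
  have Z: "Z TYPE('n) \<beta> = ?I \<beta>"
    using has_bochner_integral_integral_eq[OF I, of \<beta>] assms unfolding Z_def V_def by simp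
  have I_pos: "?I \<beta> > 0"
    using assms d by (intro divide_pos_pos mult_pos_pos Gamma_real_pos) simp_all
  have dens_nonneg: "pi_density \<beta> x \<ge> 0" for x :: "real ^ 'n"
    unfolding pi_density_def Z
    by (intro mult_nonneg_nonneg less_imp_le[OF positive_imp_inverse_positive[OF I_pos]] powr_ge_zero)
  have dens_measurable: "pi_density \<beta> \<in> borel_measurable (lborel :: (real ^ 'n) measure)"
    unfolding pi_density_def[abs_def] by measurable
  have expectation: "has_bochner_integral (pi_measure \<beta>) f (inverse (?I \<beta>) * r)"
    if "has_bochner_integral lborel (\<lambda>x. f x * V x powr (- \<beta>)) r" "f \<in> borel_measurable borel"
    for f :: "real ^ 'n \<Rightarrow> real" and r
    unfolding pi_measure_def
  proof (rule has_bochner_integral_density)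
    show "has_bochner_integral lborel (\<lambda>x. pi_density \<beta> x *\<^sub>R f x) (inverse (?I \<beta>) * r)"
      using has_bochner_integral_mult_right[OF that(1), of "inverse (?I \<beta>)"]
      by (simp add: pi_density_def Z mult_ac)
  qed (use that dens_nonneg dens_measurable in auto)
  have total: "has_bochner_integral (pi_measure \<beta>) (\<lambda>x :: real ^ 'n. 1 :: real) 1"
  proof -
    have "has_bochner_integral lborel (\<lambda>x :: real ^ 'n. 1 * V x powr (- \<beta>)) (?I \<beta>)"
      using I[of \<beta>] assms by simp
    then have "has_bochner_integral (pi_measure \<beta>) (\<lambda>x :: real ^ 'n. 1 :: real)
        (inverse (?I \<beta>) * ?I \<beta>)"
      by (rule expectation) simp
    also have "inverse (?I \<beta>) * ?I \<beta> = 1"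
      by (rule left_inverse) (use I_pos in linarith)
    finally show ?thesis .
  qed
  \<comment> \<open>Here \<open>\<beta> > d / 2 + 1\<close> is used in full: \<open>V\<close> lowers the exponent to \<open>\<beta> - 1\<close>, which must exceed \<open>d / 2\<close>.\<close>
  have "V x * V x powr (- \<beta>) = V x powr (- (\<beta> - 1))" for x :: "real ^ 'n"
    using V_pos[of x] by (simp add: powr_mult_base)
  then have EV: "has_bochner_integral (pi_measure \<beta>) (V :: real ^ 'n \<Rightarrow> real)
      (inverse (?I \<beta>) * ?I (\<beta> - 1))"
    using I[of "\<beta> - 1"] assms by (intro expectation) auto
  have ratio: "inverse (?I \<beta>) * ?I (\<beta> - 1) = (\<beta> - 1) / (\<beta> - 1 - ?d)"
  proof -
    have pos: "\<beta> - 1 > 0" "\<beta> - 1 - ?d > 0"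
      using assms d by linarith+
    have rec: "Gamma (s + 1) = s * Gamma s" if "s > 0" for s :: real
      using that by (intro Gamma_plus1) (auto elim!: nonpos_Ints_cases)
    have Gamma_rec: "Gamma \<beta> = (\<beta> - 1) * Gamma (\<beta> - 1)"
      "Gamma (\<beta> - ?d) = (\<beta> - 1 - ?d) * Gamma (\<beta> - 1 - ?d)"
      using rec[OF pos(1)] rec[OF pos(2)] by (simp_all add: algebra_simps)
    have cancel: "inverse (p * (a * v) / (b * w)) * (p * v / w) = b / a"
      if "p > 0" "v > 0" "w > 0" "a > 0" "b > 0" for p v w a b :: real
      using that by (simp add: field_simps)
    show ?thesis
      unfolding Gamma_rec by (rule cancel) (use pos in \<open>auto intro: Gamma_real_pos\<close>)
  qed
  have grad_sq: "(norm (grad V x))\<^sup>2 = 4 * (V x - 1)" for x :: "real ^ 'n"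
    by (simp add: grad_V V_def power_mult_distrib)
  have "?E (\<lambda>x. (norm (grad V x))\<^sup>2) = 4 * ((\<beta> - 1) / (\<beta> - 1 - ?d) - 1)"
    unfolding grad_sq
    using has_bochner_integral_mult_right[OF has_bochner_integral_diff[OF EV total], of 4]
    by (simp only: has_bochner_integral_integral_eq ratio)
  also have "\<dots> = 2 * real CARD('n) / (\<beta> - 1 - ?d)"
    using assms by (simp add: divide_simps)
  finally show ?thesis
    using has_bochner_integral_integral_eq[OF EV] unfolding ratio by blast
qed

end
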